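(* The sets $\mathcal{B}_{\mathrm{FPF}}(x)^{-1}=\{u^{-1}:u\in\mathcal{B}_{\mathrm{FPF}}(x)\}$, for $x$ ranging over the fixed-point-free involutions in $S_{2n}$, are exactly the distinct equivalence classes of $S_{2n}$ under $\sim_{\mathcal{B}_{\mathrm{FPF}}}$ (permutations identified with one-line sequences).
   Context: $S_{2n}$ has simple generators $s_i=(i,i+1)$ and length $\ell$. The Demazure product $\circ$ is the unique associative operation on $S_{2n}$ with $s\circ w = sw$ if $\ell(sw)>\ell(w)$ and $s\circ w=w$ otherwise, and $w\circ s=ws$ if $\ell(ws)>\ell(w)$ and $w\circ s = w$ otherwise. Let $w_{\mathrm{fpf}}=s_1s_3\cdots s_{2n-1}$ and $\mathcal{B}_{\mathrm{FPF}}(x)=\{w\in S_{2n}: w^{-1}\circ w_{\mathrm{fpf}}\circ w=x\}$. The relation $\sim_{\mathcal{B}_{\mathrm{FPF}}}$ is the smallest equivalence relation on integer sequences of length $2n$ such that: (i) for any $a,b$, a sequence with $a,b$ in positions $2i-1,2i$ is equivalent to the sequence with these two entries swapped, all other entries equal; (ii) for $a\le b\le c\le d$, sequences which agree outside positions $2i-1,2i,2i+1,2i+2$ and have in those positions respectively $[a,d,b,c]$, $[b,c,a,d]$, $[b,d,a,c]$, $[c,d,a,b]$ are all equivalent. *)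

theory Defs
  imports "HOL-Combinatorics.Permutations" "HOL-Library.FuncSet"
begin

text \<open>Permutations in \<open>S\<^sub>N\<close> are functions on \<open>nat\<close> that permute \<open>{1..N}\<close> and
  fix everything else; they are multiplied by function composition.\<close>

definition Sym :: "nat \<Rightarrow> (nat \<Rightarrow> nat) set" where
  "Sym N = {w. w permutes {1..N}}"

definition simple_refl :: "nat \<Rightarrow> nat \<Rightarrow> nat" where
  "simple_refl i = transpose i (i + 1)"

definition word_prod :: "nat list \<Rightarrow> nat \<Rightarrow> nat" where
  "word_prod is = foldr (\<circ>) (map simple_refl is) id"

definition coxeter_length :: "nat \<Rightarrow> (nat \<Rightarrow> nat) \<Rightarrow> nat" where
  "coxeter_length N w =
     (LEAST k. \<exists>is. length is = k \<and> set is \<subseteq> {1..<N} \<and> word_prod is = w)"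

text \<open>Membership in \<open>\<rightarrow>\<^sub>E\<close> says that the operation is closed on \<open>S\<^sub>N\<close> and also fixes
  its (irrelevant) values outside \<open>S\<^sub>N\<close>, so that uniqueness is meaningful.
  For \<open>N \<noteq> 2\<close> the two unit laws follow from the other conditions. For \<open>N = 2\<close> they do
  not: without them the operation with constant value \<open>simple_refl 1\<close> would also qualify.\<close>

definition is_demazure_product ::
    "nat \<Rightarrow> ((nat \<Rightarrow> nat) \<Rightarrow> (nat \<Rightarrow> nat) \<Rightarrow> (nat \<Rightarrow> nat)) \<Rightarrow> bool" where
  "is_demazure_product N f \<longleftrightarrow>
     case_prod f \<in> Sym N \<times> Sym N \<rightarrow>\<^sub>E Sym N \<and>
     (\<forall>u\<in>Sym N. \<forall>v\<in>Sym N. \<forall>w\<in>Sym N. f (f u v) w = f u (f v w)) \<and>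
     (\<forall>w\<in>Sym N. f id w = w \<and> f w id = w) \<and>
     (\<forall>i\<in>{1..<N}. \<forall>w\<in>Sym N.
        f (simple_refl i) w =
          (if coxeter_length N (simple_refl i \<circ> w) > coxeter_length N w then simple_refl i \<circ> w else w) \<and>
        f w (simple_refl i) =
          (if coxeter_length N (w \<circ> simple_refl i) > coxeter_length N w then w \<circ> simple_refl i else w))"

definition demazure :: "nat \<Rightarrow> (nat \<Rightarrow> nat) \<Rightarrow> (nat \<Rightarrow> nat) \<Rightarrow> (nat \<Rightarrow> nat)" where
  "demazure N = (THE f. is_demazure_product N f)"

definition w_fpf :: "nat \<Rightarrow> nat \<Rightarrow> nat" where
  "w_fpf n = word_prod (map (\<lambda>j. 2 * j - 1) [1..<n + 1])"

definition fpf_involutions :: "nat \<Rightarrow> (nat \<Rightarrow> nat) set" where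
  "fpf_involutions n = {x \<in> Sym (2 * n). x \<circ> x = id \<and> (\<forall>i\<in>{1..2 * n}. x i \<noteq> i)}"

definition B_FPF :: "nat \<Rightarrow> (nat \<Rightarrow> nat) \<Rightarrow> (nat \<Rightarrow> nat) set" where
  "B_FPF n x =
     {w \<in> Sym (2 * n). demazure (2 * n) (demazure (2 * n) (inv w) (w_fpf n)) w = x}"

text \<open>A prefix \<open>p\<close> of even length \<open>2 * i - 2\<close> puts the entries that follow it in the
  (1-based) positions \<open>2 * i - 1\<close>, \<open>2 * i\<close>, and so on.\<close>

inductive_set sim_FPF :: "nat \<Rightarrow> (int list \<times> int list) set" for n :: nat where
  refl: "length xs = 2 * n \<Longrightarrow> (xs, xs) \<in> sim_FPF n"
| sym: "(xs, ys) \<in> sim_FPF n \<Longrightarrow> (ys, xs) \<in> sim_FPF n"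
| trans: "(xs, ys) \<in> sim_FPF n \<Longrightarrow> (ys, zs) \<in> sim_FPF n \<Longrightarrow> (xs, zs) \<in> sim_FPF n"
| swap: "even (length p) \<Longrightarrow> length (p @ [a, b] @ q) = 2 * n \<Longrightarrow>
    (p @ [a, b] @ q, p @ [b, a] @ q) \<in> sim_FPF n"
| quad: "even (length p) \<Longrightarrow> length (p @ X @ q) = 2 * n \<Longrightarrow>
    a \<le> b \<Longrightarrow> b \<le> c \<Longrightarrow> c \<le> d \<Longrightarrow>
    X \<in> {[a, d, b, c], [b, c, a, d], [b, d, a, c], [c, d, a, b]} \<Longrightarrow>
    Y \<in> {[a, d, b, c], [b, c, a, d], [b, d, a, c], [c, d, a, b]} \<Longrightarrow>
    (p @ X @ q, p @ Y @ q) \<in> sim_FPF n"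

definition one_line :: "nat \<Rightarrow> (nat \<Rightarrow> nat) \<Rightarrow> int list" where
  "one_line N w = map (\<lambda>i. int (w i)) [1..<N + 1]"

definition Sym_seqs :: "nat \<Rightarrow> int list set" where
  "Sym_seqs N = one_line N ` Sym N"

end

theory Submission
  imports Defs
begin

text \<open>Write \<open>\<Phi>(v)\<close> for the Demazure conjugate of \<open>w_fpf\<close> by \<open>v\<close>, so that the set attached to
  \<open>x\<close> is the fibre of \<open>\<Phi>\<close> over \<open>x\<close>. Reading a one-line word as a list of \<open>n\<close> consecutive pairs, both
  generating relations preserve \<open>\<Phi>\<close>: swapping a pair is absorbed by \<open>w_fpf\<close>, and the four words of
  a quadruple relation arise from the sorted word \<open>abcd\<close> by length-increasing right multiplications
  that all conjugate \<open>s\<^sub>1 s\<^sub>3\<close> to the longest element of \<open>S\<^sub>4\<close>. Conversely, every word can be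
  rewritten into one whose pairs are increasing and listed by increasing minimum. On such words
  \<open>\<Phi>(v)\<close> is the ordinary conjugate of \<open>w_fpf\<close>, i.e. the perfect matching formed by the pairs, and
  each perfect matching has exactly one such word.\<close>

subsection \<open>Length and the exchange property\<close>

lemma simple_refl_simple_refl [simp]: "simple_refl i (simple_refl i x) = x"
  by (simp add: simple_refl_def)

lemma comp_simple_refl_cancel [simp]:
  "w \<circ> simple_refl i \<circ> simple_refl i = w"
  "simple_refl i \<circ> (simple_refl i \<circ> w) = w"
  by (simp_all add: fun_eq_iff)

lemma bij_simple_refl [simp]: "bij (simple_refl i)"
  by (simp add: simple_refl_def)

lemma inv_simple_refl [simp]: "inv (simple_refl i) = simple_refl i"
  by (simp add: simple_refl_def)

lemma simple_refl_in_Sym: "i \<in> {1..<N} \<Longrightarrow> simple_refl i \<in> Sym N"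
  by (auto simp: Sym_def simple_refl_def intro!: permutes_swap_id)

lemma id_in_Sym [simp]: "id \<in> Sym N"
  by (simp add: Sym_def permutes_id)

lemma comp_in_Sym: "u \<in> Sym N \<Longrightarrow> v \<in> Sym N \<Longrightarrow> u \<circ> v \<in> Sym N"
  by (simp add: Sym_def permutes_compose)

lemma inv_in_Sym: "u \<in> Sym N \<Longrightarrow> inv u \<in> Sym N"
  by (simp add: Sym_def permutes_inv)

lemma bij_Sym: "u \<in> Sym N \<Longrightarrow> bij u"
  by (simp add: Sym_def permutes_bij)

lemma inv_inv_Sym: "u \<in> Sym N \<Longrightarrow> inv (inv u) = u"
  by (simp add: bij_Sym inv_inv_eq)

lemma inv_comp_simple_refl: "bij w \<Longrightarrow> inv (w \<circ> simple_refl i) = simple_refl i \<circ> inv w"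
  by (simp add: o_inv_distrib)

lemma inv_simple_refl_comp: "bij w \<Longrightarrow> inv (simple_refl i \<circ> w) = inv w \<circ> simple_refl i"
  by (simp add: o_inv_distrib)

lemma simple_refl_apply [simp]:
  "simple_refl i i = Suc i" "simple_refl i (Suc i) = i"
  by (simp_all add: simple_refl_def)

lemma simple_refl_other: "x \<noteq> i \<Longrightarrow> x \<noteq> Suc i \<Longrightarrow> simple_refl i x = x"
  by (simp add: simple_refl_def)

lemma simple_refl_less_iff:
  assumes "\<not> (x = i \<and> y = Suc i)" "\<not> (x = Suc i \<and> y = i)"
  shows "simple_refl i x < simple_refl i y \<longleftrightarrow> x < y"
  using assms by (auto simp: simple_refl_def transpose_def)

text \<open>Rearrangement inequality: moving the larger value to the later position raises the
  weighted sum by \<open>w i - w (Suc i)\<close>. This makes sorting terminate.\<close>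

lemma sum_mult_simple_refl_less:
  fixes w :: "nat \<Rightarrow> nat"
  assumes "i \<in> {1..<N}" and "w (Suc i) < w i"
  shows "(\<Sum>k\<in>{1..N}. k * w k) < (\<Sum>k\<in>{1..N}. k * (w \<circ> simple_refl i) k)"
proof -
  let ?R = "{1..N} - {i, Suc i}"
  have U: "{1..N} = insert i (insert (Suc i) ?R)" using assms(1) by auto
  have e: "(\<Sum>k\<in>{1..N}. k * f k) = i * f i + (Suc i * f (Suc i) + (\<Sum>k\<in>?R. k * f k))"
    for f :: "nat \<Rightarrow> nat"
    by (subst U) simp
  have "(\<Sum>k\<in>?R. k * (w \<circ> simple_refl i) k) = (\<Sum>k\<in>?R. k * w k)"
    by (rule sum.cong) (auto simp: simple_refl_other)
  then show ?thesis unfolding e using assms(2) by simp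
qed

text \<open>Bubble sort run backwards. The step is restricted to ascents, so every multiplication
  met in an induction is one that increases length.\<close>

lemma Sym_induct_right [consumes 1, case_names id step]:
  assumes "w \<in> Sym N" and "P id"
    and step: "\<And>i w. w \<in> Sym N \<Longrightarrow> i \<in> {1..<N} \<Longrightarrow> w i < w (Suc i) \<Longrightarrow> P w \<Longrightarrow> P (w \<circ> simple_refl i)"
  shows "P w"
  using assms(1)
\<comment> \<open>Each of the \<open>N\<close> summands is at most \<open>N * N\<close>, so the
  truncated subtraction is a genuine difference and decreases strictly when a descent is
  removed.\<close>
proof (induction "N * (N * N) - (\<Sum>k\<in>{1..N}. k * w k)" arbitrary: w rule: less_induct)
  case less
  then have perm: "w permutes {1..N}" by (simp add: Sym_def)
  show ?case
  proof (cases "\<exists>i\<in>{1..<N}. w (Suc i) < w i")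
    case True
    then obtain i where i: "i \<in> {1..<N}" "w (Suc i) < w i" by blast
    let ?w = "w \<circ> simple_refl i"
    have S: "?w \<in> Sym N" using less.prems i simple_refl_in_Sym comp_in_Sym by blast
    have "k * ?w k \<le> N * N" if "k \<in> {1..N}" for k
      using that S permutes_in_image[of ?w "{1..N}" k] by (intro mult_le_mono) (auto simp: Sym_def)
    then have "(\<Sum>k\<in>{1..N}. k * ?w k) \<le> (\<Sum>k\<in>{1..N}. N * N)" by (rule sum_mono)
    then have "(\<Sum>k\<in>{1..N}. k * ?w k) \<le> N * (N * N)" by simp
    then have "P ?w"
      using sum_mult_simple_refl_less[of i N w, OF i] S by (intro less.hyps) auto
    then show ?thesis using step[OF S i(1)] i(2) by simp
  next
    case False
    have lt: "w i < w (Suc i)" if "i \<in> {1..<N}" for i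
    proof -
      have "w i \<noteq> w (Suc i)" using permutes_inj[OF perm] by (metis inj_eq n_not_Suc_n)
      then show ?thesis using False that by force
    qed
    \<comment> \<open>Without descents the values increase strictly from at least 1, so none lies
      below its argument; only the identity permutes like that.\<close>
    have "k \<le> N \<Longrightarrow> 1 \<le> k \<Longrightarrow> k \<le> w k" for k
    proof (induction k)
      case (Suc k)
      then show ?case
        using lt[of k] permutes_in_image[OF perm, of "Suc k"] by (cases "k = 0") auto
    qed simp
    then have "w = id" by (intro permutes_natset_ge[OF perm]) auto
    then show ?thesis using assms(2) by simp
  qed
qed

lemma Sym_induct_left [consumes 1, case_names id step]:
  assumes "w \<in> Sym N" and "P id"
    and step: "\<And>i w. w \<in> Sym N \<Longrightarrow> i \<in> {1..<N} \<Longrightarrow> inv w i < inv w (Suc i) \<Longrightarrow> P w \<Longrightarrow> P (simple_refl i \<circ> w)"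
  shows "P w"
proof -
  have "P (inv v)" if "v \<in> Sym N" for v
    using that
  proof (induction rule: Sym_induct_right)
    case id
    show ?case using assms(2) by (metis inv_id)
  next
    case (step i v)
    then show "P (inv (v \<circ> simple_refl i))"
      using assms(3)[of "inv v" i] unfolding inv_comp_simple_refl[OF bij_Sym[OF step(1)]]
      by (simp add: inv_in_Sym inv_inv_Sym)
  qed
  from this[OF inv_in_Sym[OF assms(1)]] show ?thesis using assms(1) by (simp add: inv_inv_Sym)
qed

section \<open>Words in the simple reflections and the length function\<close>

lemma word_prod_Nil [simp]: "word_prod [] = id"
  by (simp add: word_prod_def)

lemma word_prod_Cons [simp]: "word_prod (i # is) = simple_refl i \<circ> word_prod is"
  by (simp add: word_prod_def)

lemma word_prod_append: "word_prod (is @ js) = word_prod is \<circ> word_prod js"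
  by (induction "is") (simp_all add: comp_assoc)

lemma bij_word_prod: "bij (word_prod is)"
  by (induction "is") (simp_all only: word_prod_Nil word_prod_Cons bij_id bij_comp bij_simple_refl)

lemma inv_word_prod: "inv (word_prod is) = word_prod (rev is)"
proof (induction "is")
  case (Cons i "is")
  have "inv (word_prod (i # is)) = inv (word_prod is) \<circ> simple_refl i"
    unfolding word_prod_Cons by (rule inv_simple_refl_comp[OF bij_word_prod])
  then show ?case by (simp only: Cons rev.simps word_prod_append word_prod_Cons word_prod_Nil comp_id)
qed (simp only: word_prod_Nil rev.simps inv_id)

text \<open>Some letter \<open>i\<close> creates the descent when the word is built up from its
  right end. At that moment positions \<open>j\<close> and \<open>Suc j\<close> carry the values
  \<open>i\<close> and \<open>Suc i\<close>, so reflecting values by \<open>i\<close> equals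
  reflecting positions by \<open>j\<close>, and deleting that letter absorbs
  \<open>simple_refl j\<close>.\<close>

lemma word_prod_exchange:
  assumes "set is \<subseteq> {1..<N}" and "word_prod is (Suc j) < word_prod is j"
  shows "\<exists>is'. length is' < length is \<and> set is' \<subseteq> {1..<N} \<and> word_prod is' = word_prod is \<circ> simple_refl j"
  using assms
proof (induction "is")
  case (Cons i "is")
  let ?w = "word_prod is"
  show ?case
  proof (cases "?w (Suc j) < ?w j")
    case True
    then obtain is' where "length is' < length is" "set is' \<subseteq> {1..<N}" "word_prod is' = ?w \<circ> simple_refl j"
      using Cons by (metis insert_subset list.simps(15))
    then show ?thesis using Cons.prems by (intro exI[of _ "i # is'"]) (auto simp: comp_assoc)
  next
    case False
    have "simple_refl i (?w (Suc j)) < simple_refl i (?w j)" using Cons.prems by simp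
    with False have eq: "?w j = i" "?w (Suc j) = Suc i"
      using simple_refl_less_iff[of "?w (Suc j)" i "?w j"] by auto
    have "simple_refl i (?w (simple_refl j x)) = ?w x" for x
    proof (cases "x = j \<or> x = Suc j")
      case True
      then show ?thesis using eq by auto
    next
      case F: False
      then have "?w x \<noteq> ?w j" "?w x \<noteq> ?w (Suc j)"
        using bij_word_prod[of "is"] by (auto simp: bij_def inj_eq)
      then show ?thesis using F eq by (simp add: simple_refl_other)
    qed
    then show ?thesis using Cons.prems by (intro exI[of _ "is"]) auto
  qed
qed simp

lemma ex_word_prod: "w \<in> Sym N \<Longrightarrow> \<exists>is. set is \<subseteq> {1..<N} \<and> word_prod is = w"
proof (induction rule: Sym_induct_left)
  case id
  show ?case by (intro exI[of _ "[]"]) simp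
next
  case (step i w)
  then obtain "is" where "set is \<subseteq> {1..<N}" "word_prod is = w" by blast
  then show ?case using step by (intro exI[of _ "i # is"]) auto
qed

lemma coxeter_length_le:
  assumes "set is \<subseteq> {1..<N}"
  shows "coxeter_length N (word_prod is) \<le> length is"
  unfolding coxeter_length_def using assms by (intro Least_le) blast

lemma reduced_word:
  assumes "w \<in> Sym N"
  obtains "is" where "length is = coxeter_length N w" "set is \<subseteq> {1..<N}" "word_prod is = w"
proof -
  obtain "is" where "set is \<subseteq> {1..<N} \<and> word_prod is = w" using ex_word_prod[OF assms] by blast
  then have "\<exists>k. \<exists>is. length is = k \<and> set is \<subseteq> {1..<N} \<and> word_prod is = w" by blast
  from LeastI_ex[OF this] show ?thesis using that unfolding coxeter_length_def by blast
qed

lemma coxeter_length_descent: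
  assumes "w \<in> Sym N" and "w (Suc j) < w j"
  shows "coxeter_length N (w \<circ> simple_refl j) < coxeter_length N w"
proof -
  obtain "is" where "is": "length is = coxeter_length N w" "set is \<subseteq> {1..<N}" "word_prod is = w"
    using reduced_word[OF assms(1)] .
  with assms obtain js where "length js < length is" "set js \<subseteq> {1..<N}" "word_prod js = w \<circ> simple_refl j"
    using word_prod_exchange[of "is" N j] by auto
  then show ?thesis using coxeter_length_le[of js N] "is" by simp
qed

text \<open>Exactly one of \<open>w\<close> and \<open>w \<circ> simple_refl j\<close> has a descent
  at \<open>j\<close>, and removing it shortens. From here on length comparisons become comparisons
  of adjacent entries.\<close>

lemma coxeter_length_less_right:
  assumes "w \<in> Sym N" and "j \<in> {1..<N}"
  shows "coxeter_length N w < coxeter_length N (w \<circ> simple_refl j) \<longleftrightarrow> w j < w (Suc j)"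
proof -
  have S: "w \<circ> simple_refl j \<in> Sym N" using assms comp_in_Sym simple_refl_in_Sym by blast
  have "w j \<noteq> w (Suc j)" using bij_Sym[OF assms(1)] by (simp add: bij_def inj_eq)
  then show ?thesis
    using coxeter_length_descent[OF assms(1), of j] coxeter_length_descent[OF S, of j] by force
qed

lemma coxeter_length_inv:
  assumes "w \<in> Sym N"
  shows "coxeter_length N (inv w) = coxeter_length N w"
proof -
  have le: "coxeter_length N (inv v) \<le> coxeter_length N v" if v: "v \<in> Sym N" for v
  proof -
    obtain "is" where "length is = coxeter_length N v" "set is \<subseteq> {1..<N}" "word_prod is = v"
      using reduced_word[OF v] .
    then show ?thesis using coxeter_length_le[of "rev is" N] by (simp flip: inv_word_prod)
  qed
  show ?thesis using le[OF assms] le[OF inv_in_Sym[OF assms]] by (simp only: inv_inv_Sym[OF assms])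
qed

lemma coxeter_length_less_left:
  assumes "w \<in> Sym N" and "j \<in> {1..<N}"
  shows "coxeter_length N w < coxeter_length N (simple_refl j \<circ> w) \<longleftrightarrow> inv w j < inv w (Suc j)"
proof -
  have "simple_refl j \<circ> w \<in> Sym N" using assms comp_in_Sym simple_refl_in_Sym by blast
  from coxeter_length_inv[OF this] coxeter_length_inv[OF assms(1)]
    coxeter_length_less_right[OF inv_in_Sym[OF assms(1)] assms(2)]
  show ?thesis by (simp add: inv_simple_refl_comp bij_Sym[OF assms(1)])
qed

subsection \<open>The Demazure product\<close>

text \<open>The left Demazure action of one reflection, with the length test replaced by its
  combinatorial form; this makes it independent of \<open>N\<close>.\<close>

definition left_up :: "nat \<Rightarrow> (nat \<Rightarrow> nat) \<Rightarrow> nat \<Rightarrow> nat" where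
  "left_up i w = (if inv w i < inv w (Suc i) then simple_refl i \<circ> w else w)"

definition right_up :: "nat \<Rightarrow> (nat \<Rightarrow> nat) \<Rightarrow> nat \<Rightarrow> nat" where
  "right_up j w = (if w j < w (Suc j) then w \<circ> simple_refl j else w)"

lemma left_up_in_Sym: "i \<in> {1..<N} \<Longrightarrow> w \<in> Sym N \<Longrightarrow> left_up i w \<in> Sym N"
  by (simp add: left_up_def comp_in_Sym simple_refl_in_Sym)

lemma right_up_in_Sym: "i \<in> {1..<N} \<Longrightarrow> w \<in> Sym N \<Longrightarrow> right_up i w \<in> Sym N"
  by (simp add: right_up_def comp_in_Sym simple_refl_in_Sym)

text \<open>The source of associativity. If positions \<open>j\<close>, \<open>Suc j\<close> do not
  carry the values \<open>i\<close>, \<open>Suc i\<close>, neither multiplication affects the test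
  of the other. If they do, both multiplications give the same permutation, and either order of the
  operators returns the longer of it and \<open>w\<close>.\<close>

lemma left_up_right_up:
  assumes "bij w"
  shows "left_up i (right_up j w) = right_up j (left_up i w)"
proof -
  define v where "v = inv w"
  have iff: "w x = y \<longleftrightarrow> v y = x" for x y
    using assms unfolding v_def by (metis bij_inv_eq_iff)
  have inv1: "inv (w \<circ> simple_refl j) = simple_refl j \<circ> v"
    and inv2: "inv (simple_refl i \<circ> w) = v \<circ> simple_refl i"
    using assms by (simp_all add: v_def inv_comp_simple_refl inv_simple_refl_comp)
  show ?thesis
  proof (cases "{w j, w (Suc j)} = {i, Suc i}")
    case False
    then have n: "\<not> (w j = i \<and> w (Suc j) = Suc i)" "\<not> (w j = Suc i \<and> w (Suc j) = i)" by auto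
    then have n': "\<not> (v i = j \<and> v (Suc i) = Suc j)" "\<not> (v i = Suc j \<and> v (Suc i) = j)"
      using iff by blast+
    show ?thesis
      using simple_refl_less_iff[OF n] simple_refl_less_iff[OF n']
      by (auto simp: left_up_def right_up_def inv1 inv2 v_def[symmetric] comp_assoc)
  next
    case True
    have com: "simple_refl i \<circ> w = w \<circ> simple_refl j"
    proof
      fix x
      have inj: "w x = w y \<longleftrightarrow> x = y" for y using assms by (simp add: bij_def inj_eq)
      show "(simple_refl i \<circ> w) x = (w \<circ> simple_refl j) x"
      proof (cases "x = j \<or> x = Suc j")
        case T: True
        then show ?thesis using True by (auto simp: doubleton_eq_iff)
      next
        case F: False
        then have "w x \<notin> {w j, w (Suc j)}" using inj by auto
        then show ?thesis using F True by (simp add: simple_refl_other)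
      qed
    qed
    from True consider "w j = i" "w (Suc j) = Suc i" | "w j = Suc i" "w (Suc j) = i"
      by (auto simp: doubleton_eq_iff)
    then show ?thesis
    proof cases
      case 1
      then have "v i = j" "v (Suc i) = Suc j" using iff by auto
      with 1 show ?thesis by (simp add: left_up_def right_up_def inv1 inv2 v_def[symmetric] com)
    next
      case 2
      then have "v (Suc i) = j" "v i = Suc j" using iff by auto
      with 2 show ?thesis by (simp add: left_up_def right_up_def inv1 inv2 v_def[symmetric] com)
    qed
  qed
qed

lemma fold_left_up_in_Sym: "set is \<subseteq> {1..<N} \<Longrightarrow> w \<in> Sym N \<Longrightarrow> foldr left_up is w \<in> Sym N"
  by (induction "is") (auto intro!: left_up_in_Sym)

lemma fold_left_up_right_up:
  assumes "set is \<subseteq> {1..<N}" and "j \<in> {1..<N}" and "w \<in> Sym N"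
  shows "foldr left_up is (right_up j w) = right_up j (foldr left_up is w)"
  using assms(1)
proof (induction "is")
  case (Cons i "is")
  then have "foldr left_up is w \<in> Sym N" using assms by (intro fold_left_up_in_Sym) auto
  then show ?case using Cons left_up_right_up[OF bij_Sym] by simp
qed simp

lemma ex_fold_left_up: "w \<in> Sym N \<Longrightarrow> \<exists>is. set is \<subseteq> {1..<N} \<and> foldr left_up is id = w"
proof (induction rule: Sym_induct_left)
  case id
  show ?case by (intro exI[of _ "[]"]) simp
next
  case (step i w)
  then obtain "is" where "is": "set is \<subseteq> {1..<N}" "foldr left_up is id = w" by blast
  have "foldr left_up (i # is) id = simple_refl i \<circ> w"
    using step by (simp add: "is" left_up_def)
  then show "\<exists>is. set is \<subseteq> {1..<N} \<and> foldr left_up is id = simple_refl i \<circ> w"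
    using step "is"(1) by (intro exI[of _ "i # is"]) simp
qed

text \<open>Every \<open>w\<close> arises from \<open>id\<close> by operators \<open>right_up\<close>, and these commute with \<open>left_up\<close>.\<close>

lemma fold_left_up_eqI:
  assumes "set is \<subseteq> {1..<N}" "set js \<subseteq> {1..<N}"
    and "foldr left_up is id = foldr left_up js id" and "w \<in> Sym N"
  shows "foldr left_up is w = foldr left_up js w"
  using assms(4)
proof (induction rule: Sym_induct_right)
  case id
  show ?case by (fact assms(3))
next
  case (step i w)
  then have "w \<circ> simple_refl i = right_up i w" by (simp add: right_up_def)
  with step show ?case using assms(1,2) by (simp add: fold_left_up_right_up)
qed

text \<open>By \<open>fold_left_up_eqI\<close> any other word producing \<open>u\<close> from
  \<open>id\<close> acts in the same way; \<open>dem_eq\<close> exploits this freedom.\<close>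

definition left_word :: "nat \<Rightarrow> (nat \<Rightarrow> nat) \<Rightarrow> nat list" where
  "left_word N u = (SOME is. set is \<subseteq> {1..<N} \<and> foldr left_up is id = u)"

text \<open>The value \<open>undefined\<close> off \<open>Sym N\<close> matches the extensional
  function space in \<open>is_demazure_product\<close>.\<close>

definition dem :: "nat \<Rightarrow> (nat \<Rightarrow> nat) \<Rightarrow> (nat \<Rightarrow> nat) \<Rightarrow> (nat \<Rightarrow> nat)" where
  "dem N u v = (if u \<in> Sym N \<and> v \<in> Sym N then foldr left_up (left_word N u) v else undefined)"

lemma left_word:
  assumes "u \<in> Sym N"
  shows "set (left_word N u) \<subseteq> {1..<N}" "foldr left_up (left_word N u) id = u"
  using someI_ex[OF ex_fold_left_up[OF assms]] unfolding left_word_def by blast+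

lemma dem_eq:
  assumes "set is \<subseteq> {1..<N}" "foldr left_up is id = u" "v \<in> Sym N"
  shows "dem N u v = foldr left_up is v"
proof -
  have "u \<in> Sym N" using fold_left_up_in_Sym[of "is" N id] assms by simp
  then show ?thesis
    using assms fold_left_up_eqI[OF left_word(1) assms(1) _ assms(3), of u] left_word(2)[of u N]
    by (simp add: dem_def)
qed

lemma dem_in_Sym: "u \<in> Sym N \<Longrightarrow> v \<in> Sym N \<Longrightarrow> dem N u v \<in> Sym N"
  by (simp add: dem_def fold_left_up_in_Sym[OF left_word(1)])

text \<open>Concatenating words for \<open>u\<close> and \<open>v\<close> gives a word for their
  product, so both sides are the same fold.\<close>

lemma dem_assoc:
  assumes u: "u \<in> Sym N" and v: "v \<in> Sym N" and w: "w \<in> Sym N"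
  shows "dem N (dem N u v) w = dem N u (dem N v w)"
proof -
  let ?is = "left_word N u @ left_word N v"
  have "dem N (dem N u v) w = foldr left_up ?is w"
    using u v w by (intro dem_eq) (auto simp: dem_def left_word dest: subsetD[OF left_word(1)])
  then show ?thesis using u v w fold_left_up_in_Sym[OF left_word(1)[OF v] w] by (simp add: dem_def)
qed

lemma dem_simple_refl_left:
  assumes "i \<in> {1..<N}" "w \<in> Sym N"
  shows "dem N (simple_refl i) w = left_up i w"
  using dem_eq[of "[i]" N "simple_refl i" w] assms by (simp add: left_up_def)

text \<open>The fold only acts from the left. The right-hand law follows by writing
  \<open>simple_refl i\<close> as \<open>right_up i id\<close> and moving \<open>right_up i\<close>
  out of the fold.\<close>

lemma dem_simple_refl_right:
  assumes "i \<in> {1..<N}" "w \<in> Sym N"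
  shows "dem N w (simple_refl i) = right_up i w"
  using dem_eq[OF left_word[OF assms(2)] simple_refl_in_Sym[OF assms(1)]]
    fold_left_up_right_up[OF left_word(1)[OF assms(2)] assms(1) id_in_Sym]
  by (simp add: right_up_def left_word assms(2) split: if_splits)

lemma is_demazure_product_dem: "is_demazure_product N (dem N)"
  unfolding is_demazure_product_def
proof (intro conjI ballI)
  show "case_prod (dem N) \<in> Sym N \<times> Sym N \<rightarrow>\<^sub>E Sym N"
    by (auto simp: dem_in_Sym) (auto simp: dem_def)
next
  fix w assume "w \<in> Sym N"
  then show "dem N id w = w" "dem N w id = w"
    using dem_eq[of "[]" N id w] by (simp_all add: dem_def left_word)
next
  fix i w assume "i \<in> {1..<N}" "w \<in> Sym N"
  then show "dem N (simple_refl i) w =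
      (if coxeter_length N w < coxeter_length N (simple_refl i \<circ> w) then simple_refl i \<circ> w else w)"
    and "dem N w (simple_refl i) =
      (if coxeter_length N w < coxeter_length N (w \<circ> simple_refl i) then w \<circ> simple_refl i else w)"
    by (simp_all add: dem_simple_refl_left dem_simple_refl_right coxeter_length_less_left
        coxeter_length_less_right left_up_def right_up_def)
qed (rule dem_assoc)

text \<open>The unit law and the left reflection law, combined with associativity, determine the
  product by induction on the left factor; extensionality settles the arguments outside
  \<open>Sym N\<close>.\<close>

lemma is_demazure_product_unique:
  assumes f: "is_demazure_product N f" and g: "is_demazure_product N g"
  shows "f = g"
proof -
  have *: "f u v = g u v" if "u \<in> Sym N" and v: "v \<in> Sym N" for u v
    using that(1)
  proof (induction rule: Sym_induct_left)
    case id
    have "h id v = v" if "is_demazure_product N h" for h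
      using that v unfolding is_demazure_product_def by blast
    then show ?case using f g by metis
  next
    case (step i u)
    let ?s = "simple_refl i"
    have s: "?s \<in> Sym N" using step simple_refl_in_Sym by blast
    \<comment> \<open>Since \<open>i\<close> is a left ascent of \<open>u\<close>, the permutation
      \<open>?s \<circ> u\<close> is itself the product \<open>h ?s u\<close>, and associativity
      peels off \<open>?s\<close>.\<close>
    have ext: "h (?s \<circ> u) v = h ?s (h u v)" if h: "is_demazure_product N h" for h
    proof -
      have "h ?s u = ?s \<circ> u"
        using h step coxeter_length_less_left[of u N i] by (simp add: is_demazure_product_def)
      then show ?thesis using h s step v unfolding is_demazure_product_def by metis
    qed
    have "g u v \<in> Sym N" using g step v by (auto simp: is_demazure_product_def PiE_iff)
    then have "f ?s (g u v) = g ?s (g u v)"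
      using f g step unfolding is_demazure_product_def by simp
    then show "f (?s \<circ> u) v = g (?s \<circ> u) v" using step.IH by (simp only: ext[OF f] ext[OF g])
  qed
  have "case_prod f = case_prod g"
    by (rule PiE_ext[of _ "Sym N \<times> Sym N" "\<lambda>_. Sym N"])
      (use f g * in \<open>auto simp: is_demazure_product_def\<close>)
  then show ?thesis by (metis curry_case_prod)
qed

lemma demazure_eq: "demazure N = dem N"
  unfolding demazure_def
  using is_demazure_product_dem is_demazure_product_unique by blast

subsection \<open>Demazure conjugation\<close>

text \<open>The inverse stands on the right, opposite to \<open>B_FPF\<close>: an element
  \<open>w\<close> there enters as \<open>v = inv w\<close>, whose one-line word is the sequence to
  be rewritten.\<close>

definition conj_up :: "nat \<Rightarrow> (nat \<Rightarrow> nat) \<Rightarrow> (nat \<Rightarrow> nat) \<Rightarrow> nat \<Rightarrow> nat" where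
  "conj_up N v x = dem N (dem N v x) (inv v)"

definition up :: "nat \<Rightarrow> (nat \<Rightarrow> nat) \<Rightarrow> nat \<Rightarrow> nat" where
  "up i x = left_up i (right_up i x)"

lemma up_in_Sym: "i \<in> {1..<N} \<Longrightarrow> x \<in> Sym N \<Longrightarrow> up i x \<in> Sym N"
  by (simp add: up_def left_up_in_Sym right_up_in_Sym)

lemma up_eq_dem:
  assumes "i \<in> {1..<N}" "x \<in> Sym N"
  shows "up i x = dem N (simple_refl i) (dem N x (simple_refl i))"
  using assms by (simp add: up_def dem_simple_refl_left dem_simple_refl_right right_up_in_Sym)

lemma dem_id:
  assumes "w \<in> Sym N"
  shows "dem N id w = w" "dem N w id = w"
  using is_demazure_product_dem[of N] assms unfolding is_demazure_product_def by blast+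

lemma conj_up_id: "x \<in> Sym N \<Longrightarrow> conj_up N id x = x"
  unfolding conj_up_def inv_id by (simp only: dem_id)

lemma conj_up_in_Sym: "v \<in> Sym N \<Longrightarrow> x \<in> Sym N \<Longrightarrow> conj_up N v x \<in> Sym N"
  by (simp add: conj_up_def dem_in_Sym inv_in_Sym)

text \<open>A length-increasing product is a Demazure product, so associativity regroups the
  factors. Here the new reflection acts last, on the finished conjugate; in
  \<open>conj_up_right\<close> it acts first, on \<open>x\<close>.\<close>

lemma conj_up_left:
  assumes v: "v \<in> Sym N" and i: "i \<in> {1..<N}" and x: "x \<in> Sym N"
    and less: "inv v i < inv v (Suc i)"
  shows "conj_up N (simple_refl i \<circ> v) x = up i (conj_up N v x)"
proof -
  let ?s = "simple_refl i" and ?v' = "inv v"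
  have s: "?s \<in> Sym N" and v': "?v' \<in> Sym N" using i v by (auto simp: simple_refl_in_Sym inv_in_Sym)
  have 1: "?s \<circ> v = dem N ?s v"
    using dem_simple_refl_left[OF i v] less by (simp add: left_up_def)
  have 2: "inv (?s \<circ> v) = dem N ?v' ?s"
    unfolding inv_simple_refl_comp[OF bij_Sym[OF v]]
    using dem_simple_refl_right[OF i v'] less by (simp add: right_up_def)
  have "conj_up N (?s \<circ> v) x = dem N (dem N (dem N ?s v) x) (dem N ?v' ?s)"
    unfolding conj_up_def 2 by (simp only: 1)
  also have "\<dots> = dem N ?s (dem N (dem N (dem N v x) ?v') ?s)"
    using s v v' x by (simp add: dem_assoc dem_in_Sym)
  finally show ?thesis
    using up_eq_dem[OF i conj_up_in_Sym[OF v x]] by (simp add: conj_up_def)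
qed

lemma conj_up_right:
  assumes v: "v \<in> Sym N" and i: "i \<in> {1..<N}" and x: "x \<in> Sym N"
    and less: "v i < v (Suc i)"
  shows "conj_up N (v \<circ> simple_refl i) x = conj_up N v (up i x)"
proof -
  let ?s = "simple_refl i" and ?v' = "inv v"
  have s: "?s \<in> Sym N" and v': "?v' \<in> Sym N" using i v by (auto simp: simple_refl_in_Sym inv_in_Sym)
  have 1: "v \<circ> ?s = dem N v ?s"
    using dem_simple_refl_right[OF i v] less by (simp add: right_up_def)
  have 2: "inv (v \<circ> ?s) = dem N ?s ?v'"
    unfolding inv_comp_simple_refl[OF bij_Sym[OF v]]
    using dem_simple_refl_left[OF i v'] less by (simp add: left_up_def inv_inv_Sym[OF v])
  have "conj_up N (v \<circ> ?s) x = dem N (dem N (dem N v ?s) x) (dem N ?s ?v')"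
    unfolding conj_up_def 2 by (simp only: 1)
  also have "\<dots> = dem N (dem N v (dem N ?s (dem N x ?s))) ?v'"
    using s v v' x by (simp add: dem_assoc dem_in_Sym)
  finally show ?thesis using up_eq_dem[OF i x] by (simp add: conj_up_def)
qed

text \<open>As \<open>x\<close> is its own inverse, both one-sided tests compare \<open>x i\<close>
  with \<open>x (Suc i)\<close>. The test survives the first multiplication unless these values are
  \<open>i\<close> and \<open>Suc i\<close> in that order, which would make both points fixed. So
  the two factors are applied together or not at all.\<close>

lemma up_fpf:
  assumes invol: "x \<circ> x = id" and fpf: "x i \<noteq> i" "x (Suc i) \<noteq> Suc i"
  shows "up i x = (if x i < x (Suc i) then simple_refl i \<circ> x \<circ> simple_refl i else x)"
proof -
  have bij: "bij x" and inv: "inv x = x" using invol o_bij inv_unique_comp by blast+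
  show ?thesis
  proof (cases "x i < x (Suc i)")
    case True
    have "simple_refl i (x i) < simple_refl i (x (Suc i))"
      using True fpf by (subst simple_refl_less_iff) auto
    then show ?thesis
      using True unfolding up_def left_up_def right_up_def
      by (simp add: inv_comp_simple_refl[OF bij] inv comp_assoc)
  qed (simp add: up_def left_up_def right_up_def inv)
qed

section \<open>The base matching and its blocks of four points\<close>

lemma w_fpf_apply:
  "w_fpf n x = (if x = 0 \<or> 2 * n < x then x else if odd x then Suc x else x - 1)"
proof (induction n arbitrary: x)
  case 0
  show ?case by (simp add: w_fpf_def)
next
  case (Suc n)
  have "w_fpf (Suc n) = w_fpf n \<circ> simple_refl (Suc (2 * n))"
    by (simp add: w_fpf_def word_prod_append)
  then have *: "w_fpf (Suc n) x = w_fpf n (simple_refl (Suc (2 * n)) x)" by simp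
  consider "x = Suc (2 * n)" | "x = Suc (Suc (2 * n))" | "x \<noteq> Suc (2 * n)" "x \<noteq> Suc (Suc (2 * n))" by blast
  then show ?case
  proof cases
    case 3
    then show ?thesis unfolding * simple_refl_other[OF 3] Suc.IH by auto
  qed (unfold *, simp_all add: Suc.IH)
qed

lemma w_fpf_w_fpf: "w_fpf n (w_fpf n x) = x"
proof -
  have "Suc x \<le> 2 * n" if "odd x" "x \<le> 2 * n" using that by presburger
  then show ?thesis unfolding w_fpf_apply by auto
qed

lemma w_fpf_involutory: "w_fpf n \<circ> w_fpf n = id"
  by (auto simp: w_fpf_w_fpf)

lemma w_fpf_in_Sym: "w_fpf n \<in> Sym (2 * n)"
  unfolding Sym_def mem_Collect_eq permutes_def
proof (intro conjI allI impI)
  fix y show "\<exists>!x. w_fpf n x = y" by (metis w_fpf_w_fpf)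
qed (auto simp: w_fpf_apply)

definition fpf_conj :: "nat \<Rightarrow> (nat \<Rightarrow> nat) \<Rightarrow> nat \<Rightarrow> nat" where
  "fpf_conj n v = conj_up (2 * n) v (w_fpf n)"

text \<open>For odd \<open>j\<close> the matching \<open>w_fpf n\<close> has a descent at
  \<open>j\<close>, so \<open>up j\<close> fixes it. Applying \<open>conj_up_right\<close> to
  whichever of the two permutations ascends at \<open>j\<close> gives the equality.\<close>

lemma fpf_conj_swap:
  assumes v: "v \<in> Sym (2 * n)" and j: "odd j" "j < 2 * n"
  shows "fpf_conj n (v \<circ> simple_refl j) = fpf_conj n v"
proof -
  have J: "j \<in> {1..<2 * n}" using j by (cases j) auto
  have "up j (w_fpf n) = w_fpf n"
    using J j by (subst up_fpf[OF w_fpf_involutory]) (auto simp: w_fpf_apply)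
  then have *: "fpf_conj n (u \<circ> simple_refl j) = fpf_conj n u"
    if "u \<in> Sym (2 * n)" "u j < u (Suc j)" for u
    using conj_up_right[OF that(1) J w_fpf_in_Sym that(2)] by (simp add: fpf_conj_def)
  have "v j \<noteq> v (Suc j)" using bij_Sym[OF v] by (simp add: bij_def inj_eq)
  then consider "v j < v (Suc j)" | "v (Suc j) < v j" by linarith
  then show ?thesis
  proof cases
    case 1
    then show ?thesis using * v by blast
  next
    case 2
    have "v \<circ> simple_refl j \<in> Sym (2 * n)" using v J comp_in_Sym simple_refl_in_Sym by blast
    then show ?thesis using *[of "v \<circ> simple_refl j"] 2 by simp
  qed
qed

text \<open>On the block of four points starting at \<open>j\<close> this is the longest element of
  S_4, the top of the three perfect matchings of the block.\<close>

definition nested_fpf :: "nat \<Rightarrow> nat \<Rightarrow> nat \<Rightarrow> nat" where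
  "nested_fpf n j = (w_fpf n)(j := j + 3, j + 1 := j + 2, j + 2 := j + 1, j + 3 := j)"

text \<open>Among the three matchings of the block, \<open>up (j + 1)\<close> leads from the
  adjacent one to the crossing one, and either outer move leads on to the nested one. There
  \<open>x\<close> decreases along the block, so further moves do nothing.\<close>

lemma up_w_fpf:
  assumes "odd j" "j + 3 \<le> 2 * n"
  shows "up (j + 2) (up (j + 1) (w_fpf n)) = nested_fpf n j"
    and "up j (up (j + 1) (w_fpf n)) = nested_fpf n j"
    and "up j (nested_fpf n j) = nested_fpf n j"
    and "up (j + 1) (nested_fpf n j) = nested_fpf n j"
    and "nested_fpf n j \<in> Sym (2 * n)"
proof -
  \<comment> \<open>The crossing matching of the block, the intermediate stage.\<close>
  define y where "y = (w_fpf n)(j := j + 2, j + 1 := j + 3, j + 2 := j, j + 3 := j + 1)"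
  have "0 < j" using assms(1) by (cases j) auto
  then have w: "w_fpf n j = j + 1" "w_fpf n (j + 1) = j" "w_fpf n (j + 2) = j + 3" "w_fpf n (j + 3) = j + 2"
    using assms by (auto simp: w_fpf_apply)
  \<comment> \<open>The complement of the block is stable under \<open>w_fpf n\<close>, so
    redefining the values on the block does not interfere with those outside.\<close>
  have w': "w_fpf n i \<notin> {j, j + 1, j + 2, j + 3}" if "i \<notin> {j, j + 1, j + 2, j + 3}" for i
    using that w w_fpf_w_fpf[of n i] by auto
  have y_inv: "y \<circ> y = id"
  proof
    fix i show "(y \<circ> y) i = id i"
      using w'[of i] w_fpf_w_fpf[of n i] by (auto simp: y_def)
  qed
  have z_inv: "nested_fpf n j \<circ> nested_fpf n j = id"
  proof
    fix i show "(nested_fpf n j \<circ> nested_fpf n j) i = id i"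
      using w'[of i] w_fpf_w_fpf[of n i] by (auto simp: nested_fpf_def)
  qed
  have outside: "i = j \<or> i = j + 1 \<or> i = j + 2 \<or> i = j + 3 \<or> i \<notin> {j, j + 1, j + 2, j + 3}" for i
    by blast
  have "simple_refl (j + 1) \<circ> w_fpf n \<circ> simple_refl (j + 1) = y"
  proof
    fix i show "(simple_refl (j + 1) \<circ> w_fpf n \<circ> simple_refl (j + 1)) i = y i"
      using outside[of i] w w'[of i] by (elim disjE) (simp_all add: y_def simple_refl_def transpose_def)
  qed
  then have up_w: "up (j + 1) (w_fpf n) = y"
    using w by (subst up_fpf[OF w_fpf_involutory]) simp_all
  have "simple_refl (j + 2) \<circ> y \<circ> simple_refl (j + 2) = nested_fpf n j"
  proof
    fix i show "(simple_refl (j + 2) \<circ> y \<circ> simple_refl (j + 2)) i = nested_fpf n j i"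
      using outside[of i] w'[of i]
      by (elim disjE) (simp_all add: y_def nested_fpf_def simple_refl_def transpose_def)
  qed
  then show "up (j + 2) (up (j + 1) (w_fpf n)) = nested_fpf n j"
    unfolding up_w by (subst up_fpf[OF y_inv]) (simp_all add: y_def)
  have "simple_refl j \<circ> y \<circ> simple_refl j = nested_fpf n j"
  proof
    fix i show "(simple_refl j \<circ> y \<circ> simple_refl j) i = nested_fpf n j i"
      using outside[of i] w'[of i]
      by (elim disjE) (simp_all add: y_def nested_fpf_def simple_refl_def transpose_def)
  qed
  then show up_y: "up j (up (j + 1) (w_fpf n)) = nested_fpf n j"
    unfolding up_w by (subst up_fpf[OF y_inv]) (simp_all add: y_def)
  show "up j (nested_fpf n j) = nested_fpf n j" "up (j + 1) (nested_fpf n j) = nested_fpf n j"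
    by (subst up_fpf[OF z_inv]; simp add: nested_fpf_def)+
  show "nested_fpf n j \<in> Sym (2 * n)"
    unfolding up_y[symmetric] using assms by (intro up_in_Sym w_fpf_in_Sym) (use \<open>0 < j\<close> in auto)
qed

subsection \<open>One-line sequences\<close>

definition seq_perm :: "int list \<Rightarrow> nat \<Rightarrow> nat" where
  "seq_perm xs i = (if i \<in> {1..length xs} then nat (xs ! (i - 1)) else i)"

lemma length_one_line [simp]: "length (one_line N w) = N"
  by (simp add: one_line_def)

lemma seq_perm_one_line:
  assumes "w \<in> Sym N"
  shows "seq_perm (one_line N w) = w"
proof
  fix i
  have "i \<notin> {1..N} \<Longrightarrow> w i = i" using assms permutes_not_in[of w] by (simp add: Sym_def)
  then show "seq_perm (one_line N w) i = w i"
    by (auto simp: seq_perm_def one_line_def nth_append simp del: upt_Suc)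
qed

text \<open>This form depends only on the multiset of entries, so rearranging a word stays within
  \<open>Sym_seqs N\<close>.\<close>

lemma Sym_seqs_iff: "xs \<in> Sym_seqs N \<longleftrightarrow> distinct xs \<and> set xs = int ` {1..N}"
proof
  assume "xs \<in> Sym_seqs N"
  then obtain w where w: "w permutes {1..N}" "xs = map (int \<circ> w) [1..<N + 1]"
    by (auto simp: Sym_seqs_def Sym_def one_line_def)
  have "{1..<N + 1} = {1..N}" by auto
  then have "set xs = int ` w ` {1..N}" unfolding w(2) by (simp add: image_comp del: upt_Suc)
  moreover have "distinct xs"
    using permutes_inj_on[OF w(1)] unfolding w(2) by (auto simp: distinct_map inj_on_def)
  ultimately show "distinct xs \<and> set xs = int ` {1..N}" by (simp only: permutes_image[OF w(1)])
next
  assume xs: "distinct xs \<and> set xs = int ` {1..N}"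
  then have len: "length xs = N" using distinct_card[of xs] by (simp add: card_image)
  have mem: "xs ! k \<in> int ` {1..N}" if "k < N" for k using xs len that nth_mem[of k xs] by auto
  have inj: "inj_on (seq_perm xs) {1..N}"
  proof
    fix i j assume ij: "i \<in> {1..N}" "j \<in> {1..N}" "seq_perm xs i = seq_perm xs j"
    have "xs ! (i - 1) \<in> int ` {1..N}" "xs ! (j - 1) \<in> int ` {1..N}"
      by (rule mem; use ij in force)+
    \<comment> \<open>\<open>nat\<close> identifies all negative integers with 0, so signs must be
      known before it can be cancelled.\<close>
    then have "0 \<le> xs ! (i - 1)" "0 \<le> xs ! (j - 1)" by auto
    then have "xs ! (i - 1) = xs ! (j - 1)" using ij len by (simp add: seq_perm_def)
    moreover have "i - 1 < length xs" "j - 1 < length xs" using ij len by auto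
    ultimately have "i - 1 = j - 1" using xs nth_eq_iff_index_eq by metis
    then show "i = j" using ij by auto
  qed
  have "seq_perm xs i \<in> {1..N}" if "i \<in> {1..N}" for i
  proof -
    have "xs ! (i - 1) \<in> int ` {1..N}" by (rule mem) (use that in force)
    then show ?thesis using that len by (auto simp: seq_perm_def)
  qed
  then have "seq_perm xs ` {1..N} = {1..N}" using inj by (intro endo_inj_surj) auto
  then have "seq_perm xs permutes {1..N}"
    using inj len by (intro bij_imp_permutes) (auto simp: bij_betw_def seq_perm_def)
  moreover have "one_line N (seq_perm xs) = xs"
  proof (rule nth_equalityI)
    fix k assume "k < length (one_line N (seq_perm xs))"
    then show "one_line N (seq_perm xs) ! k = xs ! k"
      using mem[of k] len by (auto simp: one_line_def seq_perm_def simp del: upt_Suc)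
  qed (simp add: len)
  ultimately show "xs \<in> Sym_seqs N" unfolding Sym_seqs_def Sym_def by force
qed

lemma length_Sym_seqs: "xs \<in> Sym_seqs N \<Longrightarrow> length xs = N"
  by (auto simp: Sym_seqs_def)

lemma seq_perm_in_Sym: "xs \<in> Sym_seqs N \<Longrightarrow> seq_perm xs \<in> Sym N"
  by (auto simp: Sym_seqs_def seq_perm_one_line)

lemma one_line_seq_perm: "xs \<in> Sym_seqs N \<Longrightarrow> one_line N (seq_perm xs) = xs"
  by (auto simp: Sym_seqs_def seq_perm_one_line)

lemma seq_perm_less_iff:
  assumes "xs \<in> Sym_seqs N" "i < N" "j < N"
  shows "seq_perm xs (Suc i) < seq_perm xs (Suc j) \<longleftrightarrow> xs ! i < xs ! j"
proof -
  have "xs ! k \<in> int ` {1..N}" if "k < N" for k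
    using assms(1) that nth_mem[of k xs] length_Sym_seqs[OF assms(1)] by (auto simp: Sym_seqs_iff)
  from this[OF assms(2)] this[OF assms(3)] show ?thesis
    using assms length_Sym_seqs[OF assms(1)] by (auto simp: seq_perm_def)
qed

text \<open>Exchanging list entries permutes positions, hence multiplies on the right. The prefix of
  length \<open>length p\<close> puts the first exchanged entry at 1-based position
  \<open>Suc (length p)\<close>.\<close>

lemma seq_perm_swap:
  "seq_perm (p @ b # a # q) = seq_perm (p @ a # b # q) \<circ> simple_refl (Suc (length p))"
proof
  fix i
  consider "i = Suc (length p)" | "i = Suc (Suc (length p))"
    | "i \<noteq> Suc (length p)" "i \<noteq> Suc (Suc (length p))" by blast
  then show "seq_perm (p @ b # a # q) i = (seq_perm (p @ a # b # q) \<circ> simple_refl (Suc (length p))) i"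
  proof cases
    case 3
    have "(p @ b # a # q) ! (i - 1) = (p @ a # b # q) ! (i - 1)" if "0 < i"
      using 3 that by (auto simp: nth_append nth_Cons split: nat.split)
    then show ?thesis using 3 by (simp add: seq_perm_def simple_refl_other)
  qed (simp_all add: seq_perm_def nth_append)
qed

section \<open>Invariance under the generating relations\<close>

lemma conj_up_seq_swap:
  assumes S: "p @ a # b # q \<in> Sym_seqs N" and less: "a < b" and x: "x \<in> Sym N"
  shows "conj_up N (seq_perm (p @ b # a # q)) x = conj_up N (seq_perm (p @ a # b # q)) (up (Suc (length p)) x)"
proof -
  have len: "Suc (length p) < N" using length_Sym_seqs[OF S] by simp
  have "seq_perm (p @ a # b # q) (Suc (length p)) < seq_perm (p @ a # b # q) (Suc (Suc (length p)))"
    using seq_perm_less_iff[OF S, of "length p" "Suc (length p)"] len less by (simp add: nth_append)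
  then show ?thesis
    unfolding seq_perm_swap[of p b a q] using len
    by (intro conj_up_right[OF seq_perm_in_Sym[OF S] _ x]) simp_all
qed

text \<open>Sort each word by adjacent exchanges, turning every exchange into an \<open>up\<close>
  on the argument. All four routes begin with the middle exchange, giving the crossing matching, and
  continue with an outer one, giving the nested matching; any remaining exchanges are
  absorbed.\<close>

lemma fpf_conj_quad:
  assumes S: "p @ [a, b, c, d] @ q \<in> Sym_seqs (2 * n)" and p: "even (length p)"
    and abcd: "a < b" "b < c" "c < d"
    and X: "X \<in> {[a, d, b, c], [b, c, a, d], [b, d, a, c], [c, d, a, b]}"
  shows "fpf_conj n (seq_perm (p @ X @ q)) =
    conj_up (2 * n) (seq_perm (p @ [a, b, c, d] @ q)) (nested_fpf n (Suc (length p)))"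
proof -
  let ?j = "Suc (length p)"
  let ?N = "2 * n"
  have j: "odd ?j" "?j + 3 \<le> ?N" using p length_Sym_seqs[OF S] by auto
  note up = up_w_fpf[OF j]
  have mem: "p @ Y @ q \<in> Sym_seqs ?N" if "mset Y = mset [a, b, c, d]" for Y
    using S that mset_eq_imp_distinct_iff[OF that] mset_eq_setD[OF that] by (auto simp: Sym_seqs_iff)
  have w: "w_fpf n \<in> Sym ?N" by (rule w_fpf_in_Sym)
  have y: "up (?j + 1) (w_fpf n) \<in> Sym ?N" using j by (intro up_in_Sym w) auto
  note z = up(5)
  \<comment> \<open>The rules \<open>s0\<close>, \<open>s1\<close>, \<open>s2\<close> sort the
    first, middle and last adjacent entries of the block; the multiset condition keeps the word a
    permutation.\<close>
  have s0: "conj_up ?N (seq_perm (p @ [v, u, r, t] @ q)) x = conj_up ?N (seq_perm (p @ [u, v, r, t] @ q)) (up ?j x)"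
    if "u < v" "mset [u, v, r, t] = mset [a, b, c, d]" "x \<in> Sym ?N" for u v r t x
    using conj_up_seq_swap[of p u v "[r, t] @ q" ?N x] mem[OF that(2)] that by simp
  have s1: "conj_up ?N (seq_perm (p @ [r, v, u, t] @ q)) x = conj_up ?N (seq_perm (p @ [r, u, v, t] @ q)) (up (?j + 1) x)"
    if "u < v" "mset [r, u, v, t] = mset [a, b, c, d]" "x \<in> Sym ?N" for u v r t x
    using conj_up_seq_swap[of "p @ [r]" u v "[t] @ q" ?N x] mem[OF that(2)] that by simp
  have s2: "conj_up ?N (seq_perm (p @ [r, t, v, u] @ q)) x = conj_up ?N (seq_perm (p @ [r, t, u, v] @ q)) (up (?j + 2) x)"
    if "u < v" "mset [r, t, u, v] = mset [a, b, c, d]" "x \<in> Sym ?N" for u v r t x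
    using conj_up_seq_swap[of "p @ [r, t]" u v q ?N x] mem[OF that(2)] that by simp
  let ?w = "w_fpf n" and ?z = "nested_fpf n ?j"
  let ?C = "\<lambda>Y. conj_up ?N (seq_perm (p @ Y @ q))"
  have adbc: "?C [a, d, b, c] ?w = ?C [a, b, c, d] ?z"
  proof -
    have "?C [a, d, b, c] ?w = ?C [a, b, d, c] (up (?j + 1) ?w)" using abcd w by (intro s1) auto
    also have "\<dots> = ?C [a, b, c, d] ?z" unfolding up(1)[symmetric] using abcd y by (intro s2) auto
    finally show ?thesis .
  qed
  have bcad: "?C [b, c, a, d] ?w = ?C [a, b, c, d] ?z"
  proof -
    have "?C [b, c, a, d] ?w = ?C [b, a, c, d] (up (?j + 1) ?w)" using abcd w by (intro s1) auto
    also have "\<dots> = ?C [a, b, c, d] ?z" unfolding up(2)[symmetric] using abcd y by (intro s0) auto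
    finally show ?thesis .
  qed
  have badc: "?C [b, a, d, c] (up (?j + 1) ?w) = ?C [a, b, c, d] ?z"
  proof -
    have "?C [b, a, d, c] (up (?j + 1) ?w) = ?C [b, a, c, d] ?z"
      unfolding up(1)[symmetric] using abcd y by (intro s2) auto
    also have "\<dots> = ?C [a, b, c, d] (up ?j ?z)" using abcd z by (intro s0) auto
    finally show ?thesis by (simp only: up(3))
  qed
  have bdac: "?C [b, d, a, c] ?w = ?C [a, b, c, d] ?z"
  proof -
    have "?C [b, d, a, c] ?w = ?C [b, a, d, c] (up (?j + 1) ?w)" using abcd w by (intro s1) auto
    then show ?thesis by (simp only: badc)
  qed
  have cdab: "?C [c, d, a, b] ?w = ?C [a, b, c, d] ?z"
  proof -
    have "?C [c, d, a, b] ?w = ?C [c, a, d, b] (up (?j + 1) ?w)" using abcd w by (intro s1) auto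
    also have "\<dots> = ?C [c, a, b, d] ?z" unfolding up(1)[symmetric] using abcd y by (intro s2) auto
    also have "\<dots> = ?C [a, c, b, d] (up ?j ?z)" using abcd z by (intro s0) auto
    also have "\<dots> = ?C [a, c, b, d] ?z" by (simp only: up(3))
    also have "\<dots> = ?C [a, b, c, d] (up (?j + 1) ?z)" using abcd z by (intro s1) auto
    finally show ?thesis by (simp only: up(4))
  qed
  show ?thesis
    unfolding fpf_conj_def using X adbc bcad bdac cdab by blast
qed

text \<open>The relation lives on all integer sequences, while the conjugate is controlled only on
  permutations. Carrying the multiset along lets the guard \<open>xs \<in> Sym_seqs (2 * n)\<close>
  pass through symmetry and transitivity.\<close>

lemma sim_FPF_invariant:
  assumes "(xs, ys) \<in> sim_FPF n"
  shows "mset xs = mset ys \<and> length xs = 2 * n \<and>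
    (xs \<in> Sym_seqs (2 * n) \<longrightarrow> fpf_conj n (seq_perm xs) = fpf_conj n (seq_perm ys))"
proof -
  have Sym_seqs_mset: "us \<in> Sym_seqs N \<longleftrightarrow> vs \<in> Sym_seqs N" if "mset us = mset vs" for us vs N
    using mset_eq_imp_distinct_iff[OF that] mset_eq_setD[OF that] by (simp add: Sym_seqs_iff)
  from assms show ?thesis
  proof induction
    case (sym xs ys)
    then show ?case using Sym_seqs_mset[of xs ys] by (metis mset_eq_length)
  next
    case (trans xs ys zs)
    then show ?case using Sym_seqs_mset[of xs ys] by metis
  next
    case (swap p a b q)
    have "fpf_conj n (seq_perm (p @ b # a # q)) = fpf_conj n (seq_perm (p @ a # b # q))"
      if "p @ a # b # q \<in> Sym_seqs (2 * n)"
      unfolding seq_perm_swap[of p b a q] using swap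
      by (intro fpf_conj_swap seq_perm_in_Sym[OF that]) auto
    then show ?case using swap by simp
  next
    case (quad p X q a b c d Y)
    have X: "mset X = mset [a, b, c, d]" and Y: "mset Y = mset [a, b, c, d]" using quad by auto
    have "fpf_conj n (seq_perm (p @ X @ q)) = fpf_conj n (seq_perm (p @ Y @ q))"
      if "p @ X @ q \<in> Sym_seqs (2 * n)"
    proof -
      have S: "p @ [a, b, c, d] @ q \<in> Sym_seqs (2 * n)"
        using that Sym_seqs_mset[of "p @ X @ q" "p @ [a, b, c, d] @ q"] X by simp
      \<comment> \<open>Distinct entries turn the weak inequalities of the relation into strict
        ones.\<close>
      then have "a < b" "b < c" "c < d" using quad by (auto simp: Sym_seqs_iff)
      from fpf_conj_quad[OF S quad(1) this] show ?thesis using quad by metis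
    qed
    then show ?case using X Y quad by simp
  qed simp
qed

subsection \<open>Normal forms\<close>

text \<open>The standard listing of a perfect matching: each pair begins with its minimum, and the
  minima increase.\<close>

definition normal_form :: "nat \<Rightarrow> (nat \<Rightarrow> nat) \<Rightarrow> bool" where
  "normal_form n v \<longleftrightarrow>
    (\<forall>i<2 * n. odd i \<longrightarrow> v i < v (Suc i)) \<and>
    (\<forall>i<2 * n. \<forall>j<2 * n. odd i \<longrightarrow> odd j \<longrightarrow> i < j \<longrightarrow> v i < v j)"

lemma conjugate_w_fpf:
  assumes "v \<in> Sym (2 * n)"
  shows "v \<circ> w_fpf n \<circ> inv v \<in> fpf_involutions n"
proof -
  let ?y = "v \<circ> w_fpf n \<circ> inv v"
  have v: "v permutes {1..2 * n}" using assms by (simp add: Sym_def)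
  have "?y i \<noteq> i" if "i \<in> {1..2 * n}" for i
  proof
    assume "?y i = i"
    then have "w_fpf n (inv v i) = inv v i" using permutes_inverses[OF v] by (metis comp_apply)
    moreover have "inv v i \<in> {1..2 * n}" using that permutes_in_image[OF permutes_inv[OF v]] by blast
    ultimately show False by (auto simp: w_fpf_apply split: if_splits)
  qed
  moreover have "?y \<circ> ?y = id"
    by (rule ext) (simp add: permutes_inverses[OF v] w_fpf_w_fpf)
  moreover have "?y \<in> Sym (2 * n)"
    by (intro comp_in_Sym inv_in_Sym w_fpf_in_Sym assms)
  ultimately show ?thesis unfolding fpf_involutions_def by blast
qed

text \<open>Removing a left reflection preserves normal form, and restoring it always takes the
  conjugating branch of \<open>up_fpf\<close>. Thus Demazure conjugation agrees with ordinary
  conjugation at every step.\<close>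

lemma fpf_conj_normal_form:
  assumes "v \<in> Sym (2 * n)" and "normal_form n v"
  shows "fpf_conj n v = v \<circ> w_fpf n \<circ> inv v"
proof -
  let ?w = "w_fpf n"
  have "normal_form n v \<longrightarrow> fpf_conj n v = v \<circ> ?w \<circ> inv v"
    using assms(1)
  proof (induction rule: Sym_induct_left)
    case id
    have "fpf_conj n id = id \<circ> ?w \<circ> inv id"
      unfolding fpf_conj_def conj_up_id[OF w_fpf_in_Sym] inv_id by simp
    then show "normal_form n id \<longrightarrow> fpf_conj n id = id \<circ> ?w \<circ> inv id" by blast
  next
    case (step k v)
    let ?s = "simple_refl k"
    let ?v = "?s \<circ> v"
    define p q where "p = inv v k" and "q = inv v (Suc k)"
    have v: "v permutes {1..2 * n}" using step.hyps by (simp add: Sym_def)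
    have pq: "v p = k" "v q = Suc k" "p < q"
      using permutes_inverses[OF v] step.hyps by (auto simp: p_def q_def)
    have range: "p \<in> {1..2 * n}" "q \<in> {1..2 * n}"
      using permutes_in_image[OF v, of p] permutes_in_image[OF v, of q] step.hyps pq by auto
    show "normal_form n ?v \<longrightarrow> fpf_conj n ?v = ?v \<circ> ?w \<circ> inv ?v"
    proof
      assume nf: "normal_form n ?v"
      have nf1: "?v i < ?v (Suc i)" if "odd i" "i < 2 * n" for i
        using nf that unfolding normal_form_def by blast
      have nf2: "?v i < ?v j" if "odd i" "odd j" "i < j" "j < 2 * n" for i j
        using nf that unfolding normal_form_def by (meson order.strict_trans)
      \<comment> \<open>Passing from \<open>?v\<close> to \<open>v\<close> changes only the
        comparison of the values \<open>k\<close> and \<open>Suc k\<close>. These are in decreasing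
        order in \<open>?v\<close>, so no inequality required by normal form concerns them.\<close>
      have less: "v i < v j" if ij: "i < j" "?v i < ?v j" for i j
      proof -
        have inj: "v x = v y \<longleftrightarrow> x = y" for x y using permutes_inj[OF v] by (simp add: inj_eq)
        have "\<not> (v i = Suc k \<and> v j = k)" using pq ij(1) inj by (metis less_asym)
        moreover have "\<not> (v i = k \<and> v j = Suc k)" using ij(2) by auto
        ultimately show ?thesis using ij(2) simple_refl_less_iff[of "v i" k "v j"] by simp
      qed
      have "normal_form n v"
        unfolding normal_form_def using less nf1 nf2 by (meson lessI)
      then have y: "fpf_conj n v = v \<circ> ?w \<circ> inv v" using step.IH by blast
      have fwd: "v i < v (Suc i)" if "odd i" "i < 2 * n" for i using less[OF lessI] nf1 that by blast
      have odd2: "v i < v j" if "odd i" "odd j" "i < j" "j < 2 * n" for i j using less nf2 that by blast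
      have np: "?v p = Suc k" "?v q = k" using pq by simp_all
      \<comment> \<open>If \<open>p\<close> were odd, \<open>?v\<close> would have the pair minimum
        \<open>Suc k\<close> ahead of the smaller value \<open>k\<close>, contrary to normal form.
        So \<open>p\<close> is even and the partner of \<open>k\<close> in \<open>v\<close> lies
        below \<open>k\<close>; the partner of \<open>Suc k\<close> is either above
        \<open>Suc k\<close> or the minimum of a later pair.\<close>
      have wpq: "v (?w p) < v (?w q)"
      proof (cases "odd p")
        case True
        then have p: "p < 2 * n" using range by (cases "p = 2 * n") auto
        show ?thesis
        proof (cases "odd q")
          case True
          then have "q < 2 * n" using range by (cases "q = 2 * n") auto
          then show ?thesis using nf2[of p q] np \<open>odd p\<close> True pq by simp
        next
          case False
          then obtain r where r: "q = Suc r" "odd r" using range by (cases q) auto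
          then have "?v r < ?v q" using nf1[of r] range by simp
          moreover have "?v p < ?v r \<or> p = r"
            using nf2[of p r] r \<open>odd p\<close> pq range by (cases "p = r") auto
          ultimately show ?thesis using np by auto
        qed
      next
        case False
        then obtain r where r: "p = Suc r" "odd r" using range by (cases p) auto
        then have wp: "?w p = r" "v r < k" using range fwd[of r] pq by (auto simp: w_fpf_apply)
        show ?thesis
        proof (cases "odd q")
          case True
          then have q: "q < 2 * n" using range by (cases "q = 2 * n") auto
          then have "?w q = Suc q" "Suc k < v (Suc q)"
            using True range fwd[of q] pq by (auto simp: w_fpf_apply)
          then show ?thesis using wp by simp
        next
          case False
          then obtain t where t: "q = Suc t" "odd t" using range by (cases q) auto
          then have "?w q = t" using range by (auto simp: w_fpf_apply)
          then show ?thesis using wp odd2[of r t] t r pq range by simp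
        qed
      qed
      let ?y = "v \<circ> ?w \<circ> inv v"
      have "?y \<in> fpf_involutions n" by (rule conjugate_w_fpf[OF step.hyps(1)])
      then have "?y \<circ> ?y = id" "?y k \<noteq> k" "?y (Suc k) \<noteq> Suc k"
        using step.hyps unfolding fpf_involutions_def by auto
      moreover have "?y k < ?y (Suc k)" using wpq by (simp add: p_def q_def)
      ultimately have up: "up k ?y = ?s \<circ> ?y \<circ> ?s" using up_fpf by presburger
      have "fpf_conj n ?v = up k (fpf_conj n v)"
        unfolding fpf_conj_def
        using step.hyps by (intro conj_up_left w_fpf_in_Sym) auto
      then show "fpf_conj n ?v = ?v \<circ> ?w \<circ> inv ?v"
        unfolding y up inv_simple_refl_comp[OF permutes_bij[OF v]] by (simp only: comp_assoc)
    qed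
  qed
  then show ?thesis using assms(2) by blast
qed

text \<open>The common conjugate is the matching itself. At the first odd position where the words
  differ, the smaller minimum has no possible place in the other word; once the minima agree, the
  matching dictates their partners.\<close>

lemma normal_form_unique:
  assumes u: "u \<in> Sym (2 * n)" "normal_form n u" and v: "v \<in> Sym (2 * n)" "normal_form n v"
    and eq: "u \<circ> w_fpf n \<circ> inv u = v \<circ> w_fpf n \<circ> inv v"
  shows "u = v"
proof -
  let ?w = "w_fpf n"
  define x where "x = u \<circ> ?w \<circ> inv u"
  have x: "x (r i) = r (?w i)" if "r = u \<or> r = v" for r i
  proof -
    have "bij r" using that bij_Sym[OF u(1)] bij_Sym[OF v(1)] by blast
    then have "inv r (r i) = i" by (simp add: bij_def)
    moreover have "x = r \<circ> ?w \<circ> inv r" using that eq x_def by blast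
    ultimately show ?thesis by simp
  qed
  \<comment> \<open>Stated for \<open>r\<close> and \<open>t\<close> in either role, so that one
    argument excludes both directions of a strict inequality.\<close>
  have no_less: False
    if r: "r \<in> Sym (2 * n)" "normal_form n r" "r = u \<or> r = v"
      and t: "t \<in> Sym (2 * n)" "normal_form n t" "t = u \<or> t = v"
      and i: "odd i" "i < 2 * n" and IH: "\<And>j. j < i \<Longrightarrow> odd j \<Longrightarrow> r j = t j" and less: "r i < t i" for r t i
  proof -
    have rp: "r permutes {1..2 * n}" and tp: "t permutes {1..2 * n}" using r t by (auto simp: Sym_def)
    define z where "z = inv t (r i)"
    have tz: "t z = r i" using permutes_inverses[OF tp] by (simp add: z_def)
    have "0 < i" using i by (cases i) auto
    then have wi: "?w i = Suc i" "i \<in> {1..2 * n}" using i by (auto simp: w_fpf_apply)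
    have zr: "z \<in> {1..2 * n}"
      using permutes_in_image[OF tp, of z] permutes_in_image[OF rp, of i] wi tz by simp
    \<comment> \<open>Being smaller than one's partner depends only on the matching
      \<open>x\<close>, so \<open>r i\<close> also comes first in its pair in \<open>t\<close>,
      which forces \<open>z\<close> to be odd.\<close>
    have "t z < t (?w z)"
    proof -
      have "r i < r (Suc i)" using r(2) i unfolding normal_form_def by blast
      moreover have "r (Suc i) = t (?w z)" using x[OF r(3), of i] x[OF t(3), of z] wi tz by simp
      ultimately show ?thesis using tz by simp
    qed
    moreover have "t (?w z) < t z" if ev: "even z"
    proof -
      obtain k where k: "z = Suc k" "odd k" using ev zr by (cases z) auto
      then have "?w z = k" using zr by (simp add: w_fpf_apply)
      then show ?thesis using t(2) k zr unfolding normal_form_def by simp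
    qed
    ultimately have z: "odd z" by force
    then have z': "z < 2 * n" using zr by (cases "z = 2 * n") auto
    show False
    proof (cases z i rule: linorder_cases)
      case less
      then show False using IH[OF less z] tz permutes_inj[OF rp] by (metis inj_eq less_irrefl)
    next
      case equal
      then show False using tz \<open>r i < t i\<close> by simp
    next
      case greater
      then have "t i < t z" using t(2) i z z' unfolding normal_form_def by blast
      then show False using tz \<open>r i < t i\<close> by simp
    qed
  qed
  have odd: "u i = v i" if "odd i" "i < 2 * n" for i
    using that
  proof (induction i rule: less_induct)
    case (less i)
    then have "\<And>j. j < i \<Longrightarrow> odd j \<Longrightarrow> u j = v j" by simp
    then show ?case
      using no_less[of u v i] no_less[of v u i] u v less.prems by (metis linorder_neqE_nat)
  qed
  show ?thesis
  proof
    fix i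
    show "u i = v i"
    proof (cases "i \<in> {1..2 * n}")
      case False
      then show ?thesis using u v by (auto simp: Sym_def permutes_not_in)
    next
      case i: True
      show ?thesis
      proof (cases "odd i")
        case True
        then have "i < 2 * n" using i by (cases "i = 2 * n") auto
        then show ?thesis using odd True by blast
      next
        case False
        then obtain j where j: "i = Suc j" "odd j" "j < 2 * n" using i by (cases i) auto
        then have "0 < j" by (cases j) auto
        then have "?w j = i" using j by (simp add: w_fpf_apply)
        then show ?thesis using x[of u j] x[of v j] odd[of j] j by simp
      qed
    qed
  qed
qed

text \<open>List the smaller endpoints of the matching in increasing order and insert after each one
  its partner.\<close>

lemma ex_conjugate_w_fpf:
  assumes "x \<in> fpf_involutions n"
  shows "\<exists>v\<in>Sym (2 * n). normal_form n v \<and> v \<circ> w_fpf n \<circ> inv v = x"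
proof -
  have xp: "x permutes {1..2 * n}" and xx: "\<And>i. x (x i) = i" and fpf: "\<And>i. i \<in> {1..2 * n} \<Longrightarrow> x i \<noteq> i"
    using assms by (auto simp: fpf_involutions_def Sym_def fun_eq_iff)
  have xr: "x i \<in> {1..2 * n} \<longleftrightarrow> i \<in> {1..2 * n}" for i by (rule permutes_in_image[OF xp])
  define A where "A = {i \<in> {1..2 * n}. i < x i}"
  have A: "finite A" by (simp add: A_def)
  have U: "{1..2 * n} = A \<union> x ` A"
  proof (intro equalityI subsetI)
    fix i assume i: "i \<in> {1..2 * n}"
    then have "i < x i \<or> x i < x (x i)" using fpf[of i] xx by force
    then have "i \<in> A \<or> x i \<in> A" using i xr[of i] unfolding A_def by blast
    then show "i \<in> A \<union> x ` A" using xx by (metis UnCI imageI)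
  qed (use xr in \<open>auto simp: A_def\<close>)
  have "A \<inter> x ` A = {}" using xx by (auto simp: A_def)
  then have "card {1..2 * n} = card A + card (x ` A)"
    unfolding U using A by (intro card_Un_disjoint) simp_all
  then have "2 * n = card A + card (x ` A)" by simp
  moreover have "card (x ` A) = card A" using permutes_inj_on[OF xp] by (rule card_image)
  ultimately have card: "card A = n" by simp
  define l where "l = sorted_list_of_set A"
  have l: "length l = n" "set l = A" "sorted_wrt (<) l"
    using A card by (simp_all add: l_def)
  \<comment> \<open>Pair number \<open>k\<close>, counted from 0, occupies positions
    \<open>2 * k + 1\<close> and \<open>2 * k + 2\<close>; hence the index \<open>i div 2\<close>
    for odd \<open>i\<close> and \<open>i div 2 - 1\<close> for even \<open>i\<close>.\<close>
  define v where "v i = (if i \<in> {1..2 * n} then if odd i then l ! (i div 2) else x (l ! (i div 2 - 1)) else i)" for i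
  have lA: "l ! k \<in> A" if "k < n" for k using that l nth_mem by metis
  have v1: "v (2 * k + 1) = l ! k" "v (2 * k + 2) = x (l ! k)" if "k < n" for k
    using that by (auto simp: v_def)
  have split: "\<exists>k<n. i = 2 * k + 1 \<or> i = 2 * k + 2" if "i \<in> {1..2 * n}" for i
    using that by (intro exI[of _ "(i - 1) div 2"]) (simp, presburger)
  have onto: "{1..2 * n} \<subseteq> v ` {1..2 * n}"
  proof
    fix i assume "i \<in> {1..2 * n}"
    then obtain a where "a \<in> A" "i = a \<or> i = x a" using U by blast
    then obtain k where k: "k < n" "i = l ! k \<or> i = x (l ! k)" using l by (metis in_set_conv_nth)
    then have "i = v (2 * k + 1) \<or> i = v (2 * k + 2)" using v1 by simp
    moreover have "2 * k + 1 \<in> {1..2 * n}" "2 * k + 2 \<in> {1..2 * n}" using k by auto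
    ultimately show "i \<in> v ` {1..2 * n}" by blast
  qed
  have "v i \<in> {1..2 * n}" if i: "i \<in> {1..2 * n}" for i
  proof -
    obtain k where "k < n" "i = 2 * k + 1 \<or> i = 2 * k + 2" using split[OF i] by blast
    then show ?thesis using v1[of k] lA[of k] xr[of "l ! k"] by (auto simp: A_def)
  qed
  then have im: "v ` {1..2 * n} = {1..2 * n}" using onto by blast
  then have "inj_on v {1..2 * n}" by (intro eq_card_imp_inj_on) simp_all
  then have vp: "v permutes {1..2 * n}"
    using im by (intro bij_imp_permutes) (auto simp: bij_betw_def v_def)
  have "v (w_fpf n i) = x (v i)" for i
  proof (cases "i \<in> {1..2 * n}")
    case True
    then obtain k where k: "k < n" "i = 2 * k + 1 \<or> i = 2 * k + 2" using split by blast
    then have "w_fpf n (2 * k + 1) = 2 * k + 2" "w_fpf n (2 * k + 2) = 2 * k + 1"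
      by (auto simp: w_fpf_apply)
    then show ?thesis using k v1[of k] xx by auto
  next
    case False
    then have "w_fpf n i = i" "v i = i" "x i = i"
      using permutes_not_in[OF xp] by (auto simp: w_fpf_apply v_def)
    then show ?thesis by simp
  qed
  then have "v \<circ> w_fpf n \<circ> inv v = x"
    by (auto simp: fun_eq_iff permutes_inverses[OF vp])
  moreover have "normal_form n v"
    unfolding normal_form_def
  proof (intro conjI allI impI)
    fix i assume "i < 2 * n" "odd i"
    then obtain k where k: "i = 2 * k + 1" "k < n" by (auto elim!: oddE)
    then show "v i < v (Suc i)" using v1[of k] lA[of k] by (simp add: A_def)
  next
    fix i j assume "i < 2 * n" "j < 2 * n" "odd i" "odd j" "i < j"
    then obtain k m where "i = 2 * k + 1" "j = 2 * m + 1" "k < m" "m < n" by (auto elim!: oddE)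
    then show "v i < v j" using v1(1)[of k] v1(1)[of m] l sorted_wrt_nth_less[of "(<)" l k m] by simp
  qed
  ultimately show ?thesis using vp unfolding Sym_def by blast
qed

section \<open>Rewriting a word to normal form\<close>

lemma split_at_pair:
  assumes "Suc k < length xs"
  shows "xs = take k xs @ [xs ! k, xs ! Suc k] @ drop (Suc (Suc k)) xs"
proof -
  have "xs = take k xs @ drop k xs" by simp
  also have "drop k xs = xs ! k # xs ! Suc k # drop (Suc (Suc k)) xs"
    using assms by (metis Cons_nth_drop_Suc Suc_lessD)
  finally show ?thesis by simp
qed

lemma sim_FPF_Sym_seqs:
  assumes "(xs, ys) \<in> sim_FPF n" and "xs \<in> Sym_seqs (2 * n)"
  shows "ys \<in> Sym_seqs (2 * n)"
proof -
  have m: "mset xs = mset ys" using sim_FPF_invariant[OF assms(1)] by blast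
  show ?thesis using assms(2) mset_eq_imp_distinct_iff[OF m] mset_eq_setD[OF m] by (simp add: Sym_seqs_iff)
qed

text \<open>A lexicographically minimal member of an equivalence class is in normal form: if two adjacent
  blocks have their minima in the wrong order, then one of the other three forms in a \<open>quad\<close>
  relation starts with the smaller minimum.\<close>

lemma ex_sim_normal_form:
  assumes S: "xs \<in> Sym_seqs (2 * n)"
  obtains ys where "(xs, ys) \<in> sim_FPF n" "ys \<in> Sym_seqs (2 * n)" "normal_form n (seq_perm ys)"
proof -
  let ?N = "2 * n"
  let ?C = "{ys. (xs, ys) \<in> sim_FPF n}"
  have "xs \<in> ?C" using sim_FPF.refl length_Sym_seqs[OF S] by blast
  \<comment> \<open>Passing to natural numbers by \<open>map nat\<close> makes the lexicographic
    order well-founded; it loses no comparison because entries of permutation words are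
    positive.\<close>
  then obtain ys where ys: "(xs, ys) \<in> sim_FPF n"
    and min: "\<And>zs. (zs, ys) \<in> inv_image (lex less_than) (map nat) \<Longrightarrow> zs \<notin> ?C"
    using wfE_min[OF wf_inv_image[OF wf_lex[OF wf_less_than]], of xs ?C "map nat"] by blast
  have ysS: "ys \<in> Sym_seqs ?N" using sim_FPF_Sym_seqs[OF ys S] .
  then have len: "length ys = ?N" and dist: "distinct ys" and pos: "\<And>k. k < ?N \<Longrightarrow> 0 < ys ! k"
    using length_Sym_seqs[OF ysS] nth_mem[of _ ys] by (force simp: Sym_seqs_iff)+
  have no_lex: "\<not> b < a"
    if "ys = p @ a # q" "(ys, p @ b # q') \<in> sim_FPF n" "length q' = length q" "0 < b" for p a b q q'
  proof
    assume "b < a"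
    then have "(p @ b # q', ys) \<in> inv_image (lex less_than) (map nat)"
      using that by (auto simp: lex_conv intro!: exI[of _ "map nat p"])
    then show False using min sim_FPF.trans[OF ys that(2)] by blast
  qed
  have ne: "ys ! i \<noteq> ys ! j" if "i < ?N" "j < ?N" "i \<noteq> j" for i j
    using that dist len by (simp add: nth_eq_iff_index_eq)
  have pair: "ys ! k < ys ! Suc k" if k: "even k" "Suc k < ?N" for k
  proof -
    let ?p = "take k ys" and ?a = "ys ! k" and ?b = "ys ! Suc k" and ?q = "drop (Suc (Suc k)) ys"
    have e: "ys = ?p @ [?a, ?b] @ ?q" using split_at_pair[of k ys] k len by simp
    have "(?p @ [?a, ?b] @ ?q, ?p @ [?b, ?a] @ ?q) \<in> sim_FPF n"
      using k len by (intro sim_FPF.swap) (simp_all add: min_def)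
    then have "(ys, ?p @ ?b # ?a # ?q) \<in> sim_FPF n" using e by simp
    then have "\<not> ?b < ?a" using e k pos by (intro no_lex[of ?p ?a "?b # ?q"]) auto
    then show ?thesis using ne[of k "Suc k"] k by simp
  qed
  have mins: "ys ! k < ys ! (k + 2)" if k: "even k" "k + 3 < ?N" for k
  proof (rule ccontr)
    assume "\<not> ?thesis"
    then have less: "ys ! (k + 2) < ys ! k" using ne[of k "k + 2"] k by simp
    let ?p = "take k ys" and ?q = "drop (k + 4) ys"
    let ?a = "ys ! k" and ?b = "ys ! (k + 1)" and ?c = "ys ! (k + 2)" and ?d = "ys ! (k + 3)"
    have e: "ys = ?p @ [?a, ?b, ?c, ?d] @ ?q"
      proof -
      have "drop (k + 2) ys = [?c, ?d] @ ?q"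
        using split_at_pair[of 0 "drop (k + 2) ys"] k len by (simp add: numeral_eq_Suc)
      then show ?thesis using split_at_pair[of k ys] k len by (simp add: numeral_eq_Suc)
    qed
    have ab: "?a < ?b" "?c < ?d" using pair[of k] pair[of "Suc (Suc k)"] k by (simp_all add: numeral_3_eq_3)
    have bd: "?b \<noteq> ?d" "?a \<noteq> ?d" using ne k by simp_all
    have quad: "(?p @ X @ ?q, ?p @ Y @ ?q) \<in> sim_FPF n"
      if "u \<le> v" "v \<le> w" "w \<le> z" "length X = 4"
        "X \<in> {[u, z, v, w], [v, w, u, z], [v, z, u, w], [w, z, u, v]}"
        "Y \<in> {[u, z, v, w], [v, w, u, z], [v, z, u, w], [w, z, u, v]}" for X Y u v w z
      using that k len by (intro sim_FPF.quad[of _ _ _ _ u v w z]) (simp_all add: min_def)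
    \<comment> \<open>Here \<open>?c\<close> is the least of the four entries. The position of
      \<open>?d\<close> relative to \<open>?a\<close> and \<open>?b\<close> decides which of the
      three forms not starting with the least entry is present; the replacement is the form
      \<open>[u, z, v, w]\<close> with \<open>u = ?c\<close>.\<close>
    have "\<exists>r s t. (?p @ [?a, ?b, ?c, ?d] @ ?q, ?p @ [?c, r, s, t] @ ?q) \<in> sim_FPF n"
    proof -
      consider "?d < ?a" | "?a < ?d" "?d < ?b" | "?b < ?d" using bd by linarith
      then show ?thesis
      proof cases
        case 1
        then show ?thesis using ab less by (intro exI quad[of ?c ?d ?a ?b]) auto
      next
        case 2
        then show ?thesis using ab less by (intro exI quad[of ?c ?a ?d ?b]) auto
      next
        case 3
        then show ?thesis using ab less by (intro exI quad[of ?c ?a ?b ?d]) auto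
      qed
    qed
    then obtain r s t where "(ys, ?p @ ?c # [r, s, t] @ ?q) \<in> sim_FPF n" using e by auto
    then have "\<not> ?c < ?a"
      using e k pos by (intro no_lex[of ?p ?a "[?b, ?c, ?d] @ ?q"]) auto
    then show False using less by simp
  qed
  have iff: "seq_perm ys i < seq_perm ys j \<longleftrightarrow> ys ! (i - 1) < ys ! (j - 1)"
    if "i \<in> {1..?N}" "j \<in> {1..?N}" for i j
    using seq_perm_less_iff[OF ysS, of "i - 1" "j - 1"] that by auto
  have "normal_form n (seq_perm ys)"
    unfolding normal_form_def
  proof (intro conjI allI impI)
    fix i assume "i < ?N" "odd i"
    moreover from this obtain m where "i = 2 * m + 1" by (auto elim!: oddE)
    ultimately show "seq_perm ys i < seq_perm ys (Suc i)" using pair[of "i - 1"] iff[of i "Suc i"] by simp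
  next
    fix i j assume *: "i < ?N" "j < ?N" "odd i" "odd j" "i < j"
    then obtain k m where km: "i = 2 * k + 1" "j = 2 * m + 1" "k < m" "m < n" by (auto elim!: oddE)
    have "k < m \<Longrightarrow> m < n \<Longrightarrow> ys ! (2 * k) < ys ! (2 * m)" for k m
    proof (induction m)
      case (Suc m)
      then show ?case using mins[of "2 * m"] by (cases "k = m") auto
    qed simp
    then show "seq_perm ys i < seq_perm ys j" using iff[of i j] km by simp
  qed
  then show ?thesis using that ys ysS by blast
qed

section \<open>Equivalence classes as fibres of the conjugation map\<close>

lemma fpf_conj_in_fpf_involutions:
  assumes "xs \<in> Sym_seqs (2 * n)"
  shows "fpf_conj n (seq_perm xs) \<in> fpf_involutions n"
proof -
  obtain ys where ys: "(xs, ys) \<in> sim_FPF n" "ys \<in> Sym_seqs (2 * n)" "normal_form n (seq_perm ys)"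
    using ex_sim_normal_form[OF assms] .
  then have "fpf_conj n (seq_perm xs) = fpf_conj n (seq_perm ys)"
    using sim_FPF_invariant[OF ys(1)] assms by blast
  then show ?thesis
    using conjugate_w_fpf fpf_conj_normal_form[OF seq_perm_in_Sym ys(3)] seq_perm_in_Sym[OF ys(2)] ys(2) by simp
qed

text \<open>For the converse, both words are rewritten to normal form. Their conjugates still agree,
  so uniqueness makes the two normal forms equal.\<close>

lemma sim_FPF_iff:
  assumes xs: "xs \<in> Sym_seqs (2 * n)" and ys: "ys \<in> Sym_seqs (2 * n)"
  shows "(xs, ys) \<in> sim_FPF n \<longleftrightarrow> fpf_conj n (seq_perm xs) = fpf_conj n (seq_perm ys)"
proof
  assume "(xs, ys) \<in> sim_FPF n"
  then show "fpf_conj n (seq_perm xs) = fpf_conj n (seq_perm ys)"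
    using sim_FPF_invariant xs by blast
next
  assume eq: "fpf_conj n (seq_perm xs) = fpf_conj n (seq_perm ys)"
  obtain us where us: "(xs, us) \<in> sim_FPF n" "us \<in> Sym_seqs (2 * n)" "normal_form n (seq_perm us)"
    using ex_sim_normal_form[OF xs] .
  obtain vs where vs: "(ys, vs) \<in> sim_FPF n" "vs \<in> Sym_seqs (2 * n)" "normal_form n (seq_perm vs)"
    using ex_sim_normal_form[OF ys] .
  have "fpf_conj n (seq_perm us) = fpf_conj n (seq_perm vs)"
    using eq sim_FPF_invariant[OF us(1)] sim_FPF_invariant[OF vs(1)] xs ys by metis
  then have "seq_perm us = seq_perm vs"
    unfolding fpf_conj_normal_form[OF seq_perm_in_Sym[OF us(2)] us(3)]
      fpf_conj_normal_form[OF seq_perm_in_Sym[OF vs(2)] vs(3)]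
    by (rule normal_form_unique[OF seq_perm_in_Sym[OF us(2)] us(3) seq_perm_in_Sym[OF vs(2)] vs(3)])
  then have "us = vs" using one_line_seq_perm us(2) vs(2) by metis
  then show "(xs, ys) \<in> sim_FPF n" using us(1) vs(1) sim_FPF.sym sim_FPF.trans by blast
qed

lemma one_line_B_FPF:
  "one_line (2 * n) ` {inv u |u. u \<in> B_FPF n x} = {xs \<in> Sym_seqs (2 * n). fpf_conj n (seq_perm xs) = x}"
proof (intro equalityI subsetI)
  fix xs assume "xs \<in> one_line (2 * n) ` {inv u |u. u \<in> B_FPF n x}"
  then obtain u where u: "u \<in> B_FPF n x" "xs = one_line (2 * n) (inv u)" by blast
  then have S: "u \<in> Sym (2 * n)" by (simp add: B_FPF_def)
  have "fpf_conj n (inv u) = x"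
    using u(1) unfolding fpf_conj_def conj_up_def inv_inv_Sym[OF S] by (simp add: B_FPF_def demazure_eq)
  then show "xs \<in> {xs \<in> Sym_seqs (2 * n). fpf_conj n (seq_perm xs) = x}"
    using u(2) inv_in_Sym[OF S] by (simp add: seq_perm_one_line Sym_seqs_def)
next
  fix xs assume xs: "xs \<in> {xs \<in> Sym_seqs (2 * n). fpf_conj n (seq_perm xs) = x}"
  let ?v = "seq_perm xs"
  have S: "?v \<in> Sym (2 * n)" using xs seq_perm_in_Sym by blast
  then have "inv ?v \<in> B_FPF n x"
    using xs unfolding B_FPF_def mem_Collect_eq inv_inv_Sym[OF S]
    by (simp add: inv_in_Sym fpf_conj_def conj_up_def demazure_eq)
  moreover have "xs = one_line (2 * n) (inv (inv ?v))"
    unfolding inv_inv_Sym[OF S] using xs one_line_seq_perm by force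
  ultimately show "xs \<in> one_line (2 * n) ` {inv u |u. u \<in> B_FPF n x}" by blast
qed

text \<open>The classes of the kernel of a map are its fibres. Taking \<open>F\<close> to be the
  exact image makes every fibre nonempty, so distinct points have distinct fibres.\<close>

lemma bij_betw_fibres_quotient:
  assumes f: "f ` S = F" and R: "R = {(a, b) \<in> S \<times> S. f a = f b}"
  shows "bij_betw (\<lambda>x. {a \<in> S. f a = x}) F (S // R)"
proof (rule bij_betwI')
  fix x y assume "x \<in> F" "y \<in> F"
  then show "({a \<in> S. f a = x} = {a \<in> S. f a = y}) = (x = y)" using f by blast
next
  fix x assume "x \<in> F"
  then obtain a where "a \<in> S" "f a = x" using f by blast
  then have "{a \<in> S. f a = x} = R `` {a}" unfolding R by auto
  then show "{a \<in> S. f a = x} \<in> S // R" using \<open>a \<in> S\<close> by (simp add: quotientI)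
next
  fix X assume "X \<in> S // R"
  then obtain a where "a \<in> S" "X = R `` {a}" by (rule quotientE)
  then have "X = {b \<in> S. f b = f a}" unfolding R by auto
  then show "\<exists>x\<in>F. X = {a \<in> S. f a = x}" using f \<open>a \<in> S\<close> by blast
qed

theorem theorem6p20:
  fixes n :: nat
  shows "bij_betw (\<lambda>x. one_line (2 * n) ` {inv u |u. u \<in> B_FPF n x})
           (fpf_involutions n)
           (Sym_seqs (2 * n) // (sim_FPF n \<inter> Sym_seqs (2 * n) \<times> Sym_seqs (2 * n)))"
  unfolding one_line_B_FPF
proof (rule bij_betw_fibres_quotient)
  \<comment> \<open>Surjectivity: the normal-form word of the matching \<open>x\<close> has
    conjugate \<open>x\<close>.\<close>
  have "\<exists>xs\<in>Sym_seqs (2 * n). fpf_conj n (seq_perm xs) = x" if x: "x \<in> fpf_involutions n" for x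
  proof -
    obtain v where v: "v \<in> Sym (2 * n)" "normal_form n v" "v \<circ> w_fpf n \<circ> inv v = x"
      using ex_conjugate_w_fpf[OF x] by blast
    then have "fpf_conj n (seq_perm (one_line (2 * n) v)) = x"
      by (simp add: seq_perm_one_line fpf_conj_normal_form)
    then show ?thesis using v(1) unfolding Sym_seqs_def by blast
  qed
  then show "(\<lambda>xs. fpf_conj n (seq_perm xs)) ` Sym_seqs (2 * n) = fpf_involutions n"
    using fpf_conj_in_fpf_involutions by blast
  show "sim_FPF n \<inter> Sym_seqs (2 * n) \<times> Sym_seqs (2 * n) =
      {(xs, ys) \<in> Sym_seqs (2 * n) \<times> Sym_seqs (2 * n). fpf_conj n (seq_perm xs) = fpf_conj n (seq_perm ys)}"
    using sim_FPF_iff by auto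
qed

end
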